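(* A total function $f:\mathbb{N}^p\to\mathbb{N}$ is ODE computable if and only if it is total recursive.
   Context: Discrete ODE scheme: given $g:\mathbb{N}^p\to\mathbb{N}$ and $h:\mathbb{Z}\times\mathbb{N}^{p+1}\to\mathbb{Z}$, $\mathrm{ODE}(g,h)$ is the unique $f:\mathbb{N}^{p+1}\to\mathbb{Z}$ with $f(0,\mathbf y)=g(\mathbf y)$ and $f(x+1,\mathbf y)-f(x,\mathbf y)=h(f(x,\mathbf y),x,\mathbf y)$. Let $\mathcal{C}$ be the smallest class of functions containing the zero function $\mathbf 0$, the projections $\pi^p_i$, the successor $s(n)=n+1$, and closed under composition and the discrete ODE scheme. A total function $f:\mathbb{N}^p\to\mathbb{N}$ is ODE computable if there exist functions $h_1,h_2:\mathbb{N}^{p+1}\to\mathbb{N}$ in $\mathcal{C}$ such that for all $\mathbf y$: there exists $T$ with $h_2(T,\mathbf y)\neq0$, and $f(\mathbf y)=h_1(T,\mathbf y)$ where $T$ is the smallest such value.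
   Formalization: Read literally, every function in C is nonnegative and monotone, so parity would not be ODE computable; here an integer function is in C when its positive and negative parts, as functions of naturals coding integer arguments as pairs, are in C, so the ODE scheme allows negative right-hand sides. *)

theory Defs
  imports Main
begin

text \<open>
  A function on \<open>\<nat>\<^sup>p\<close> is a function on lists, paired with its arity \<open>p\<close>; only its values on lists
  of length \<open>p\<close> matter. An element of \<open>\<int> \<times> \<nat>\<^sup>p\<^sup>+\<^sup>1\<close> is given by an integer and a list of length \<open>Suc p\<close>.
\<close>

definition is_ODE ::
  "nat \<Rightarrow> (nat list \<Rightarrow> nat) \<Rightarrow> (int \<Rightarrow> nat list \<Rightarrow> int) \<Rightarrow> (nat list \<Rightarrow> int) \<Rightarrow> bool" where
  "is_ODE p g h f \<longleftrightarrow> (\<forall>ys. length ys = p \<longrightarrow>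
     f (0 # ys) = int (g ys) \<and>
     (\<forall>x. f (Suc x # ys) - f (x # ys) = h (f (x # ys)) (x # ys)))"

lemma is_ODE_exists: "\<exists>f. is_ODE p g h f"
proof -
  define F where "F = (\<lambda>x ys. rec_nat (int (g ys)) (\<lambda>n r. r + h r (n # ys)) x)"
  have "is_ODE p g h (\<lambda>v. F (hd v) (tl v))"
    by (simp add: is_ODE_def F_def)
  then show ?thesis by blast
qed

lemma is_ODE_unique:
  assumes "is_ODE p g h f" "is_ODE p g h f'" "length v = Suc p"
  shows "f v = f' v"
proof -
  obtain x ys where v: "v = x # ys" "length ys = p"
    using assms(3) by (auto simp: length_Suc_conv)
  have "f (x # ys) = f' (x # ys)"
  proof (induction x)
    case 0
    then show ?case using assms v by (simp add: is_ODE_def)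
  next
    case (Suc x)
    have "f (Suc x # ys) = f (x # ys) + h (f (x # ys)) (x # ys)"
      "f' (Suc x # ys) = f' (x # ys) + h (f' (x # ys)) (x # ys)"
      using assms v unfolding is_ODE_def by (metis add.commute diff_add_cancel)+
    then show ?case using Suc by simp
  qed
  then show ?thesis using v by simp
qed

text \<open>
  The basic functions are functions of natural numbers, while the ODE scheme involves
  \<open>h : \<int> \<times> \<nat>\<^sup>p\<^sup>+\<^sup>1 \<rightarrow> \<int>\<close> and \<open>f : \<nat>\<^sup>p\<^sup>+\<^sup>1 \<rightarrow> \<int>\<close>, so a convention is needed for what it means that an
  integer function belongs to the class. Here an integer \<open>z\<close> is the pair of naturals
  \<open>(max z 0, max (-z) 0)\<close>, and an integer function belongs to the class if both components
  of its value, as functions of the naturals encoding the arguments, do. A function with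
  values in \<open>\<nat>\<close> is thus in the class as an integer function iff it is as a function into \<open>\<nat>\<close>.

  The convention is not innocuous. If instead integers are only ever transported by
  projections, successor and composition, no negative value is ever produced: every function
  of the class is then nonnegative and nondecreasing in each argument on nonnegative
  arguments, and, for example, the parity function is not ODE computable.
\<close>

definition represents ::
  "nat \<Rightarrow> (nat list \<Rightarrow> nat) \<Rightarrow> (nat list \<Rightarrow> nat) \<Rightarrow> (int \<Rightarrow> nat list \<Rightarrow> int) \<Rightarrow> bool" where
  "represents p hp hn h \<longleftrightarrow> (\<forall>z v. length v = Suc p \<longrightarrow>
     nat (h z v) = hp (nat z # nat (- z) # v) \<and>
     nat (- h z v) = hn (nat z # nat (- z) # v))"

inductive ode_class :: "nat \<Rightarrow> (nat list \<Rightarrow> nat) \<Rightarrow> bool" where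
  zero: "ode_class p (\<lambda>v. 0)"
| proj: "i < p \<Longrightarrow> ode_class p (\<lambda>v. v ! i)"
| succ: "ode_class 1 (\<lambda>v. v ! 0 + 1)"
| comp: "ode_class (length gs) f \<Longrightarrow> (\<And>g. g \<in> set gs \<Longrightarrow> ode_class p g) \<Longrightarrow>
    ode_class p (\<lambda>v. f (map (\<lambda>g. g v) gs))"
| ode_pos: "ode_class p g \<Longrightarrow> ode_class (p + 3) hp \<Longrightarrow> ode_class (p + 3) hn \<Longrightarrow>
    represents p hp hn h \<Longrightarrow> is_ODE p g h f \<Longrightarrow> ode_class (p + 1) (\<lambda>v. nat (f v))"
| ode_neg: "ode_class p g \<Longrightarrow> ode_class (p + 3) hp \<Longrightarrow> ode_class (p + 3) hn \<Longrightarrow>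
    represents p hp hn h \<Longrightarrow> is_ODE p g h f \<Longrightarrow> ode_class (p + 1) (\<lambda>v. nat (- f v))"
| ext: "ode_class p f \<Longrightarrow> (\<And>v. length v = p \<Longrightarrow> f' v = f v) \<Longrightarrow> ode_class p f'"

definition ode_computable :: "nat \<Rightarrow> (nat list \<Rightarrow> nat) \<Rightarrow> bool" where
  "ode_computable p f \<longleftrightarrow> (\<exists>h1 h2. ode_class (p + 1) h1 \<and> ode_class (p + 1) h2 \<and>
     (\<forall>ys. length ys = p \<longrightarrow>
        (\<exists>T. h2 (T # ys) \<noteq> 0) \<and> f ys = h1 ((LEAST T. h2 (T # ys) \<noteq> 0) # ys)))"

primrec prim_rec ::
  "(nat list \<Rightarrow> nat option) \<Rightarrow> (nat list \<Rightarrow> nat option) \<Rightarrow> nat \<Rightarrow> nat list \<Rightarrow> nat option" where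
  "prim_rec G H 0 ys = G ys"
| "prim_rec G H (Suc x) ys = Option.bind (prim_rec G H x ys) (\<lambda>r. H (r # x # ys))"

definition minimize :: "(nat list \<Rightarrow> nat option) \<Rightarrow> nat list \<Rightarrow> nat option" where
  "minimize F ys =
     (if \<exists>n. F (n # ys) = Some 0 \<and> (\<forall>m<n. F (m # ys) \<noteq> None)
      then Some (LEAST n. F (n # ys) = Some 0) else None)"

inductive partial_recursive :: "nat \<Rightarrow> (nat list \<Rightarrow> nat option) \<Rightarrow> bool" where
  zero: "partial_recursive p (\<lambda>v. Some 0)"
| proj: "i < p \<Longrightarrow> partial_recursive p (\<lambda>v. Some (v ! i))"
| succ: "partial_recursive 1 (\<lambda>v. Some (v ! 0 + 1))"
| comp: "partial_recursive (length Gs) F \<Longrightarrow> (\<And>G. G \<in> set Gs \<Longrightarrow> partial_recursive p G) \<Longrightarrow>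
    partial_recursive p (\<lambda>v. Option.bind (those (map (\<lambda>G. G v) Gs)) F)"
| prim_rec: "partial_recursive p G \<Longrightarrow> partial_recursive (p + 2) H \<Longrightarrow>
    partial_recursive (p + 1) (\<lambda>v. prim_rec G H (hd v) (tl v))"
| minimize: "partial_recursive (p + 1) F \<Longrightarrow> partial_recursive p (minimize F)"
| ext: "partial_recursive p F \<Longrightarrow> (\<And>v. length v = p \<Longrightarrow> F' v = F v) \<Longrightarrow> partial_recursive p F'"

definition total_recursive :: "nat \<Rightarrow> (nat list \<Rightarrow> nat) \<Rightarrow> bool" where
  "total_recursive p f \<longleftrightarrow> partial_recursive p (\<lambda>v. Some (f v))"

end

theory Submission
  imports Defs "HOL.Filter"
begin

text \<open>
  A primitive recursion with values in the naturals is the discrete ODE whose right-hand side is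
  the (signed) difference of consecutive values, and conversely an integer ODE is a primitive
  recursion on codes of integers. So the class consists of the primitive recursive functions. What
  remains is Kleene's normal form theorem, which needs no coding of programs here: by induction on
  the derivation of a partial recursive \<open>F\<close> one obtains a primitive recursive \<open>E\<close> such that
  \<open>E (T # ys)\<close> is \<open>0\<close> as long as the resource bound \<open>T\<close> does not suffice to evaluate \<open>F ys\<close>, and
  the successor of the value otherwise.
\<close>

section \<open>Classes closed under composition and primitive recursion\<close>

text \<open>Composition is kept apart from primitive recursion because for \<open>ode_class\<close>
  truncated subtraction has to be obtained first, from composition and a single ODE.\<close>

locale composition_closed =
  fixes C :: "nat \<Rightarrow> (nat list \<Rightarrow> nat) \<Rightarrow> bool"
  assumes zero: "C p (\<lambda>v. 0)"
    and nth: "i < p \<Longrightarrow> C p (\<lambda>v. v ! i)"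
    and succ: "C 1 (\<lambda>v. v ! 0 + 1)"
    and compose: "C (length gs) f \<Longrightarrow> (\<And>g. g \<in> set gs \<Longrightarrow> C p g) \<Longrightarrow>
      C p (\<lambda>v. f (map (\<lambda>g. g v) gs))"
    and cong: "C p f \<Longrightarrow> (\<And>v. length v = p \<Longrightarrow> f' v = f v) \<Longrightarrow> C p f'"
begin

text \<open>Substitution for the first \<open>k\<close> arguments, the others being kept as
  parameters: these are passed on by the projections \<open>?ps\<close>, so that this is again a
  composition.\<close>

lemma comp_drop:
  assumes f: "C (length gs + n) f" and gs: "\<forall>g\<in>set gs. C (n + k) g"
  shows "C (n + k) (\<lambda>v. f (map (\<lambda>g. g v) gs @ drop k v))"
proof -
  let ?ps = "map (\<lambda>i v. v ! (k + i)) [0..<n]"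
  have "C (n + k) (\<lambda>v. f (map (\<lambda>g. g v) (gs @ ?ps)))"
    by (rule compose) (use f gs in \<open>auto intro: nth\<close>)
  then show ?thesis
  proof (rule cong)
    fix v :: "nat list"
    assume "length v = n + k"
    then have "map (\<lambda>g. g v) ?ps = drop k v"
      by (auto intro: nth_equalityI)
    then show "f (map (\<lambda>g. g v) gs @ drop k v) = f (map (\<lambda>g. g v) (gs @ ?ps))"
      by simp
  qed
qed

lemma comp1: "C 1 f \<Longrightarrow> C p a \<Longrightarrow> C p (\<lambda>v. f [a v])"
  using compose[of "[a]" f p] by simp

lemma comp2: "C 2 f \<Longrightarrow> C p a \<Longrightarrow> C p b \<Longrightarrow> C p (\<lambda>v. f [a v, b v])"
  using compose[of "[a, b]" f p] by (auto simp: numeral_2_eq_2)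

lemma Suc: "C p a \<Longrightarrow> C p (\<lambda>v. Suc (a v))"
  using comp1[OF succ] by simp

lemma const: "C p (\<lambda>v. c)"
  by (induction c) (auto intro: zero Suc)

end

locale primrec_closed = composition_closed +
  assumes prim_rec: "C p g \<Longrightarrow> C (p + 2) h \<Longrightarrow>
      C (p + 1) (\<lambda>v. rec_nat (g (tl v)) (\<lambda>x r. h (r # x # tl v)) (hd v))"
begin

text \<open>With \<open>k = 0\<close> nothing is dropped in \<open>comp_drop\<close>: the bound
  \<open>n v\<close> is put in front of all of \<open>v\<close> and so may depend on the
  parameters.\<close>

lemma rec_nat:
  assumes "C p n" "C p g" "C (p + 2) h"
  shows "C p (\<lambda>v. rec_nat (g v) (\<lambda>x r. h (r # x # v)) (n v))"
  using comp_drop[of "[n]" p, OF _, of "\<lambda>v. rec_nat (g (tl v)) (\<lambda>x r. h (r # x # tl v)) (hd v)" 0]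
    prim_rec[OF assms(2,3)] assms(1)
  by simp

text \<open>A recursion of length \<open>c v\<close> that starts at \<open>a v\<close> and whose
  step ignores the previous value and returns \<open>b v\<close>.\<close>

lemma if_zero:
  assumes "C p c" "C p a" "C p b"
  shows "C p (\<lambda>v. if c v = 0 then a v else b v)"
proof -
  have "C (p + 2) (\<lambda>v. b (drop 2 v))"
    using comp_drop[of "[]" p b 2] assms(3) by simp
  from rec_nat[OF assms(1,2) this] show ?thesis
    by (rule cong) (auto simp: gr0_conv_Suc)
qed

section \<open>Elementary arithmetic by primitive recursion\<close>

lemma pred: "C p a \<Longrightarrow> C p (\<lambda>v. a v - 1)"
proof (rule cong[OF rec_nat[where n = a and g = "\<lambda>v. 0" and h = "\<lambda>v. v ! 1"]])
  have "n - 1 = rec_nat 0 (\<lambda>x _. x) n" for n :: nat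
    by (cases n) auto
  then show "a v - 1 = rec_nat 0 (\<lambda>x r. (r # x # v) ! 1) (a v)" for v
    by simp
qed (auto intro!: zero nth)

lemma add: "C p a \<Longrightarrow> C p b \<Longrightarrow> C p (\<lambda>v. a v + b v)"
proof (rule cong[OF rec_nat[where n = b and g = a and h = "\<lambda>v. Suc (v ! 0)"]])
  have "x + n = rec_nat x (\<lambda>_ r. Suc r) n" for x n :: nat
    by (induction n) auto
  then show "a v + b v = rec_nat (a v) (\<lambda>x r. Suc ((r # x # v) ! 0)) (b v)" for v
    by simp
qed (assumption | simp add: Suc nth)+

lemma diff: "C p a \<Longrightarrow> C p b \<Longrightarrow> C p (\<lambda>v. a v - b v)"
proof (rule cong[OF rec_nat[where n = b and g = a and h = "\<lambda>v. v ! 0 - 1"]])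
  have "rec_nat x (\<lambda>_ r. r - 1) n = x - n" for x n :: nat
    by (induction n) auto
  then show "a v - b v = rec_nat (a v) (\<lambda>x r. (r # x # v) ! 0 - 1) (b v)" for v
    by simp
qed (assumption | simp add: pred[simplified] nth)+

lemma mod2: "C p a \<Longrightarrow> C p (\<lambda>v. a v mod 2)"
proof (rule cong[OF rec_nat[where n = a and g = "\<lambda>v. 0" and h = "\<lambda>v. 1 - v ! 0"]])
  have "rec_nat 0 (\<lambda>_ r. 1 - r) n = n mod 2" for n :: nat
    by (induction n) (auto simp: mod_Suc)
  then show "a v mod 2 = rec_nat 0 (\<lambda>x r. 1 - (r # x # v) ! 0) (a v)" for v
    by simp
qed (auto intro!: zero diff const nth)

lemma div2: "C p a \<Longrightarrow> C p (\<lambda>v. a v div 2)"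
proof (rule cong[OF rec_nat[where n = a and g = "\<lambda>v. 0" and h = "\<lambda>v. v ! 0 + v ! 1 mod 2"]])
  have "rec_nat 0 (\<lambda>x r. r + x mod 2) n = n div 2" for n :: nat
    by (induction n) (auto, presburger)
  then show "a v div 2 = rec_nat 0 (\<lambda>x r. (r # x # v) ! 0 + (r # x # v) ! 1 mod 2) (a v)" for v
    by simp
qed (auto intro!: zero add mod2 nth)

lemma if_any_zero:
  assumes "\<And>e. e \<in> set es \<Longrightarrow> C p e" "C p b"
  shows "C p (\<lambda>v. if \<exists>e\<in>set es. e v = 0 then 0 else b v)"
  using assms
proof (induction es)
  case Nil
  then show ?case by simp
next
  case (Cons e es)
  then have "C p (\<lambda>v. if e v = 0 then 0 else if \<exists>e\<in>set es. e v = 0 then 0 else b v)"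
    by (intro if_zero zero) auto
  then show ?case by (rule cong) auto
qed

end

section \<open>The discrete ODE scheme as primitive recursion on codes of integers\<close>

text \<open>The zigzag code: \<open>z \<ge> 0\<close> goes to \<open>2 * z\<close> and
  \<open>z < 0\<close> to \<open>2 * (- z) + 1\<close>. It lets a recursion on a single natural
  carry an integer. Only sums, successor and a test for zero occur, which \<open>add\<close>,
  \<open>Suc\<close> and \<open>if_zero\<close> cover.\<close>

definition int_code :: "int \<Rightarrow> nat" where
  "int_code z = (if nat (- z) = 0 then nat z + nat z else Suc (nat (- z) + nat (- z)))"

definition code_pos :: "nat \<Rightarrow> nat" where
  "code_pos n = (if n mod 2 = 0 then n div 2 else 0)"

definition code_neg :: "nat \<Rightarrow> nat" where
  "code_neg n = (if n mod 2 = 0 then 0 else n div 2)"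

lemma code_pos_int_code [simp]: "code_pos (int_code z) = nat z"
  and code_neg_int_code [simp]: "code_neg (int_code z) = nat (- z)"
  by (simp_all add: code_pos_def code_neg_def int_code_def flip: mult_2)

context primrec_closed
begin

lemma code_pos: "C p a \<Longrightarrow> C p (\<lambda>v. code_pos (a v))"
  unfolding code_pos_def by (intro if_zero mod2 div2 zero)

lemma code_neg: "C p a \<Longrightarrow> C p (\<lambda>v. code_neg (a v))"
  unfolding code_neg_def by (intro if_zero mod2 div2 zero)

text \<open>The recursion runs on the code of \<open>f (x # ys)\<close>: decode the value, evaluate
  both components of the increment, add, encode again.\<close>

lemma ODE_code:
  assumes g: "C p g" and hp: "C (p + 3) hp" and hn: "C (p + 3) hn"
    and rep: "represents p hp hn h" and ode: "is_ODE p g h f"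
  shows "C (p + 1) (\<lambda>v. int_code (f v))"
proof -
  define args where "args = (\<lambda>v. [code_pos (v ! 0), code_neg (v ! 0), v ! 1] @ drop 2 v)"
  define P where "P = (\<lambda>v. code_pos (v ! 0) + hp (args v))"
  define N where "N = (\<lambda>v. code_neg (v ! 0) + hn (args v))"
  \<comment> \<open>The new value is the integer difference of \<open>P v\<close> and
    \<open>N v\<close>; the truncated differences are its positive and negative part, doubled as in
    \<open>int_code\<close>.\<close>
  define step where "step = (\<lambda>v. if N v - P v = 0 then (P v - N v) + (P v - N v)
    else Suc ((N v - P v) + (N v - P v)))"
  have args: "C (p + 2) (\<lambda>v. q (args v))" if "C (p + 3) q" for q
    using comp_drop[of "[\<lambda>v. code_pos (v ! 0), \<lambda>v. code_neg (v ! 0), \<lambda>v. v ! 1]" p q 2] that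
    by (simp add: args_def numeral_3_eq_3 code_pos code_neg nth)
  have "C (p + 2) P" "C (p + 2) N"
    unfolding P_def N_def by (intro add code_pos code_neg nth args hp hn; simp)+
  then have step: "C (p + 2) step"
    unfolding step_def by (intro if_zero add diff Suc)
  have step_int_code: "step (int_code z # v) = int_code (z + h z v)" if len: "length v = Suc p" for z v
  proof -
    obtain x ys where v: "v = x # ys"
      using len by (cases v) auto
    have "args (int_code z # v) = nat z # nat (- z) # v"
      by (simp add: args_def v)
    then have "P (int_code z # v) = nat z + nat (h z v)"
      "N (int_code z # v) = nat (- z) + nat (- h z v)"
      using rep len by (simp_all add: P_def N_def represents_def)
    moreover have "nat z + nat d - (nat (- z) + nat (- d)) = nat (z + d)"
      "nat (- z) + nat (- d) - (nat z + nat d) = nat (- (z + d))" for d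
      by arith+
    ultimately show ?thesis
      unfolding step_def int_code_def[of "z + h z v"] by (simp only:)
  qed
  have g2: "C p (\<lambda>v. g v + g v)"
    by (intro add g)
  from prim_rec[OF g2 step] show ?thesis
  proof (rule cong)
    fix v :: "nat list"
    assume "length v = p + 1"
    then obtain x ys where v: "v = x # ys" and ys: "length ys = p"
      by (cases v) auto
    have f0: "f (0 # ys) = int (g ys)"
      and fS: "f (Suc x # ys) = f (x # ys) + h (f (x # ys)) (x # ys)" for x
      using ode ys unfolding is_ODE_def by (simp, metis add.commute diff_add_cancel)
    have "int_code (f (x # ys)) = rec_nat (g ys + g ys) (\<lambda>x r. step (r # x # ys)) x" for x
    proof (induction x)
      case 0
      then show ?case by (simp add: f0 int_code_def)
    next
      case (Suc x)
      then show ?case using step_int_code[of "x # ys" "f (x # ys)"] ys by (simp add: fS)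
    qed
    then show "int_code (f v) =
        rec_nat (g (tl v) + g (tl v)) (\<lambda>x r. step (r # x # tl v)) (hd v)"
      by (simp add: v)
  qed
qed

lemma ode_class_subset: "ode_class p f \<Longrightarrow> C p f"
proof (induction rule: ode_class.induct)
  case (ode_pos p g hp hn h f)
  then show ?case using code_pos[OF ODE_code] by simp
next
  case (ode_neg p g hp hn h f)
  then show ?case using code_neg[OF ODE_code] by simp
next
  case (ext p f f')
  from ext.IH ext.hyps(2) show ?case by (rule cong)
qed (fact zero, erule nth, fact succ, rule compose)

end

section \<open>Total recursive functions\<close>

lemma those_eq_Some_iff: "those xs = Some ys \<longleftrightarrow> xs = map Some ys"
proof (induction xs arbitrary: ys)
  case (Cons x xs)
  then show ?case by (cases ys; cases x) auto
qed auto

lemma prim_rec_Some: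
  "prim_rec (\<lambda>v. Some (g v)) (\<lambda>v. Some (h v)) x ys = Some (rec_nat (g ys) (\<lambda>x r. h (r # x # ys)) x)"
  by (induction x) auto

interpretation total: primrec_closed total_recursive
proof
  show "total_recursive p (\<lambda>v. 0)" for p
    unfolding total_recursive_def by (rule partial_recursive.zero)
  show "total_recursive p (\<lambda>v. v ! i)" if "i < p" for p i
    unfolding total_recursive_def using that by (rule partial_recursive.proj)
  show "total_recursive 1 (\<lambda>v. v ! 0 + 1)"
    unfolding total_recursive_def by (rule partial_recursive.succ)
  show "total_recursive p (\<lambda>v. f (map (\<lambda>g. g v) gs))"
    if "total_recursive (length gs) f" "\<And>g. g \<in> set gs \<Longrightarrow> total_recursive p g" for gs f p
  proof -
    have "partial_recursive p (\<lambda>v. Option.bind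
        (those (map (\<lambda>G. G v) (map (\<lambda>g v. Some (g v)) gs))) (\<lambda>v. Some (f v)))"
      using that unfolding total_recursive_def by (intro partial_recursive.comp) auto
    moreover have "those (map (\<lambda>g. Some (g v)) gs) = Some (map (\<lambda>g. g v) gs)" for v
      by (simp add: those_eq_Some_iff comp_def)
    ultimately show ?thesis
      by (simp add: total_recursive_def comp_def)
  qed
  show "total_recursive p f'"
    if "total_recursive p f" "\<And>v. length v = p \<Longrightarrow> f' v = f v" for p f f'
    using that(1) unfolding total_recursive_def
    by (rule partial_recursive.ext) (simp add: that(2))
  show "total_recursive (p + 1) (\<lambda>v. rec_nat (g (tl v)) (\<lambda>x r. h (r # x # tl v)) (hd v))"
    if "total_recursive p g" "total_recursive (p + 2) h" for p g h
    using partial_recursive.prim_rec that unfolding total_recursive_def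
    by (fastforce simp: prim_rec_Some)
qed

lemma total_recursive_Least:
  assumes "total_recursive (p + 1) h" and ex: "\<And>ys. length ys = p \<Longrightarrow> \<exists>n. h (n # ys) \<noteq> 0"
  shows "total_recursive p (\<lambda>ys. LEAST n. h (n # ys) \<noteq> 0)"
proof -
  \<comment> \<open>\<open>minimize\<close> looks for a zero, so \<open>1 - h v\<close> exchanges
    zero and nonzero.\<close>
  let ?F = "\<lambda>v. Some (1 - h v)"
  have "partial_recursive (p + 1) ?F"
    using total.diff[OF total.const assms(1)] by (simp add: total_recursive_def)
  then have "partial_recursive p (minimize ?F)"
    by (rule partial_recursive.minimize)
  then show ?thesis
    unfolding total_recursive_def
  proof (rule partial_recursive.ext)
    fix ys :: "nat list"
    assume "length ys = p"
    moreover have "?F v = Some 0 \<longleftrightarrow> h v \<noteq> 0" for v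
      by auto
    ultimately show "Some (LEAST n. h (n # ys) \<noteq> 0) = minimize ?F ys"
      using ex unfolding minimize_def by simp
  qed
qed

lemma ode_computable_imp_total_recursive:
  assumes "ode_computable p f"
  shows "total_recursive p f"
proof -
  obtain h1 h2 where h: "ode_class (p + 1) h1" "ode_class (p + 1) h2"
    and f: "\<And>ys. length ys = p \<Longrightarrow>
      (\<exists>T. h2 (T # ys) \<noteq> 0) \<and> f ys = h1 ((LEAST T. h2 (T # ys) \<noteq> 0) # ys)"
    using assms unfolding ode_computable_def by blast
  let ?T = "\<lambda>ys. LEAST T. h2 (T # ys) \<noteq> 0"
  have "total_recursive p ?T"
    by (rule total_recursive_Least) (use total.ode_class_subset[OF h(2)] f in auto)
  with total.ode_class_subset[OF h(1)] have "total_recursive p (\<lambda>ys. h1 (?T ys # ys))"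
    using total.comp_drop[of "[?T]" p h1 0] by simp
  then show ?thesis by (rule total.cong) (simp add: f)
qed

section \<open>Primitive recursion as a discrete ODE\<close>

interpretation ode: composition_closed ode_class
  by standard (fact ode_class.zero, erule ode_class.proj, fact ode_class.succ,
    rule ode_class.comp, assumption, assumption, rule ode_class.ext)

text \<open>With initial value \<open>y\<close> and increment \<open>- 1\<close> the ODE has the
  integer solution \<open>y - x\<close>, whose positive part is truncated subtraction. This is where
  negative values enter.\<close>

lemma ode_class_diff:
  assumes "ode_class p a" "ode_class p b"
  shows "ode_class p (\<lambda>v. a v - b v)"
proof -
  have "ode_class (1 + 1) (\<lambda>v. nat ((\<lambda>v. int (v ! 1) - int (v ! 0)) v))"
  proof (rule ode_class.ode_pos)
    show "ode_class 1 (\<lambda>v. v ! 0)" by (simp add: ode.nth)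
    show "ode_class (1 + 3) (\<lambda>v. 0)" "ode_class (1 + 3) (\<lambda>v. 1)" by (rule ode.const)+
    show "represents 1 (\<lambda>v. 0) (\<lambda>v. 1) (\<lambda>_ _. - 1)" by (simp add: represents_def)
    show "is_ODE 1 (\<lambda>v. v ! 0) (\<lambda>_ _. - 1) (\<lambda>v. int (v ! 1) - int (v ! 0))"
      by (simp add: is_ODE_def)
  qed
  then have "ode_class 2 (\<lambda>v. v ! 1 - v ! 0)"
    by (simp add: numeral_2_eq_2 nat_diff_distrib')
  \<comment> \<open>The subtrahend is the time variable \<open>v ! 0\<close>, hence the exchanged
    order of the arguments.\<close>
  from ode.comp2[OF this assms(2,1)] show ?thesis by simp
qed

interpretation ode: primrec_closed ode_class
proof
  fix p g h
  assume g: "ode_class p g" and h: "ode_class (p + 2) h"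
  let ?f = "\<lambda>v. rec_nat (g (tl v)) (\<lambda>x r. h (r # x # tl v)) (hd v)"
  \<comment> \<open>The arguments are the positive and negative part of the current value, then
    \<open>x # ys\<close>. The negative part \<open>v ! 1\<close> is dropped, as the solution is
    never negative.\<close>
  let ?h = "\<lambda>v. h ([v ! 0] @ drop 2 v)"
  have "ode_class (Suc p + 2) ?h"
    using ode.comp_drop[of "[\<lambda>v. v ! 0]" "Suc p" h 2] h by (simp add: ode.nth)
  then have *: "ode_class (p + 3) ?h"
    by (simp add: numeral_3_eq_3)
  have "ode_class (p + 1) (\<lambda>v. nat ((\<lambda>v. int (?f v)) v))"
  proof (rule ode_class.ode_pos)
    show "ode_class p g" by fact
    show "ode_class (p + 3) (\<lambda>v. ?h v - v ! 0)" "ode_class (p + 3) (\<lambda>v. v ! 0 - ?h v)"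
      by (intro ode_class_diff * ode.nth; simp)+
    \<comment> \<open>The increment must be defined for every integer \<open>z\<close>; along the
      solution \<open>nat z\<close> agrees with \<open>z\<close>.\<close>
    show "represents p (\<lambda>v. ?h v - v ! 0) (\<lambda>v. v ! 0 - ?h v)
        (\<lambda>z v. int (h (nat z # v)) - int (nat z))"
      by (auto simp: represents_def nat_diff_distrib')
    show "is_ODE p g (\<lambda>z v. int (h (nat z # v)) - int (nat z)) (\<lambda>v. int (?f v))"
      by (simp add: is_ODE_def)
  qed
  then show "ode_class (p + 1) ?f" by simp
qed

section \<open>Resource-bounded evaluation of partial recursive functions\<close>

text \<open>A nonzero \<open>E (T # ys)\<close> is correct for every \<open>T\<close>, hence already
  at the least \<open>T\<close> where it occurs. Convergence is asked for all large
  \<open>T\<close>, so that finitely many subcomputations can share one \<open>T\<close>.\<close>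

definition approximates ::
  "nat \<Rightarrow> (nat list \<Rightarrow> nat) \<Rightarrow> (nat list \<Rightarrow> nat option) \<Rightarrow> bool" where
  "approximates p E F \<longleftrightarrow> (\<forall>ys. length ys = p \<longrightarrow>
     (\<forall>T v. E (T # ys) = Suc v \<longrightarrow> F ys = Some v) \<and>
     (\<forall>v. F ys = Some v \<longrightarrow> (\<forall>\<^sub>F T in sequentially. E (T # ys) = Suc v)))"

lemma approximatesI:
  assumes "\<And>ys T v. length ys = p \<Longrightarrow> E (T # ys) = Suc v \<Longrightarrow> F ys = Some v"
    and "\<And>ys v. length ys = p \<Longrightarrow> F ys = Some v \<Longrightarrow>
      \<forall>\<^sub>F T in sequentially. E (T # ys) = Suc v"
  shows "approximates p E F"
  using assms by (auto simp: approximates_def)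

lemma approximates_sound:
  "approximates p E F \<Longrightarrow> length ys = p \<Longrightarrow> E (T # ys) = Suc v \<Longrightarrow> F ys = Some v"
  by (auto simp: approximates_def)

lemma approximates_complete:
  "approximates p E F \<Longrightarrow> length ys = p \<Longrightarrow> F ys = Some v \<Longrightarrow>
    \<forall>\<^sub>F T in sequentially. E (T # ys) = Suc v"
  by (auto simp: approximates_def)

text \<open>One \<open>T\<close> serves \<open>E\<close> and all the \<open>e G\<close>. The
  predecessors are values only once every \<open>e G v\<close> is nonzero, hence the guard.\<close>

lemma approximates_comp:
  assumes E: "approximates (length Gs) E F" and eG: "\<And>G. G \<in> set Gs \<Longrightarrow> approximates p (e G) G"
  shows "approximates p
    (\<lambda>v. if \<exists>a\<in>set (map e Gs). a v = 0 then 0 else E (v ! 0 # map (\<lambda>G. e G v - 1) Gs))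
    (\<lambda>v. Option.bind (those (map (\<lambda>G. G v) Gs)) F)"
proof (rule approximatesI)
  fix ys T v
  assume ys: "length ys = p" and "(if \<exists>a\<in>set (map e Gs). a (T # ys) = 0 then 0
    else E ((T # ys) ! 0 # map (\<lambda>G. e G (T # ys) - 1) Gs)) = Suc v"
  then have nz: "\<And>G. G \<in> set Gs \<Longrightarrow> e G (T # ys) \<noteq> 0"
    and v: "E (T # map (\<lambda>G. e G (T # ys) - 1) Gs) = Suc v"
    by (auto split: if_splits)
  have "G ys = Some (e G (T # ys) - 1)" if "G \<in> set Gs" for G
    by (rule approximates_sound[OF eG[OF that] ys, of T]) (use nz[OF that] in simp)
  then have "those (map (\<lambda>G. G ys) Gs) = Some (map (\<lambda>G. e G (T # ys) - 1) Gs)"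
    by (simp add: those_eq_Some_iff)
  then show "Option.bind (those (map (\<lambda>G. G ys) Gs)) F = Some v"
    using approximates_sound[OF E _ v] by simp
next
  fix ys v
  assume ys: "length ys = p" and "Option.bind (those (map (\<lambda>G. G ys) Gs)) F = Some v"
  then obtain us where us: "map (\<lambda>G. G ys) Gs = map Some us" and v: "F us = Some v"
    by (auto simp: bind_eq_Some_conv those_eq_Some_iff)
  have len: "length us = length Gs"
    using us by (metis length_map)
  have G: "G ys = Some (the (G ys))" if "G \<in> set Gs" for G
    using that us by (metis (no_types, lifting) imageE image_eqI list.set_map option.sel)
  have us_eq: "us = map (\<lambda>G. the (G ys)) Gs"
    using arg_cong[OF us, of "map the"] by (simp add: comp_def)
  have "\<forall>\<^sub>F T in sequentially. \<forall>G\<in>set Gs. e G (T # ys) = Suc (the (G ys))"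
    by (intro eventually_ball_finite ballI approximates_complete[OF eG ys] G) auto
  moreover have "\<forall>\<^sub>F T in sequentially. E (T # us) = Suc v"
    by (rule approximates_complete[OF E len v])
  ultimately show "\<forall>\<^sub>F T in sequentially. (if \<exists>a\<in>set (map e Gs). a (T # ys) = 0 then 0
    else E ((T # ys) ! 0 # map (\<lambda>G. e G (T # ys) - 1) Gs)) = Suc v"
  proof eventually_elim
    case (elim T)
    then have "map (\<lambda>G. e G (T # ys) - 1) Gs = us"
      by (simp add: us_eq)
    with elim show ?case by auto
  qed
qed

text \<open>Here \<open>v ! 0\<close> is \<open>T\<close>, \<open>v ! 1\<close> the recursion
  variable and \<open>drop 2 v\<close> the parameters. A \<open>0\<close> propagates, so that an
  unevaluated stage is never mistaken for a value; convergence combines one threshold for each of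
  finitely many stages.\<close>

lemma approximates_prim_rec:
  assumes G: "approximates p EG G" and H: "approximates (p + 2) EH H"
  shows "approximates (p + 1)
    (\<lambda>v. rec_nat (EG (v ! 0 # drop 2 v))
      (\<lambda>x r. if r = 0 then 0 else EH (v ! 0 # (r - 1) # x # drop 2 v)) (v ! 1))
    (\<lambda>v. prim_rec G H (hd v) (tl v))"
proof -
  define R where "R = (\<lambda>T ys. rec_nat (EG (T # ys))
      (\<lambda>x r. if r = 0 then 0 else EH (T # (r - 1) # x # ys)))"
  have R_Suc: "R T ys (Suc x) = (if R T ys x = 0 then 0 else EH (T # (R T ys x - 1) # x # ys))"
    for T ys x
    by (simp add: R_def)
  have sound: "prim_rec G H x ys = Some v" if "length ys = p" "R T ys x = Suc v" for x ys T v
    using that(2)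
  proof (induction x arbitrary: v)
    case 0
    then show ?case using approximates_sound[OF G that(1)] by (simp add: R_def)
  next
    case (Suc x)
    then obtain u where u: "R T ys x = Suc u" "EH (T # u # x # ys) = Suc v"
      by (cases "R T ys x") (auto simp: R_Suc)
    then show ?case using Suc.IH[OF u(1)] approximates_sound[OF H _ u(2)] that(1) by simp
  qed
  have complete: "\<forall>\<^sub>F T in sequentially. R T ys x = Suc v"
    if "length ys = p" "prim_rec G H x ys = Some v" for x ys v
    using that(2)
  proof (induction x arbitrary: v)
    case 0
    then show ?case using approximates_complete[OF G that(1)] by (simp add: R_def)
  next
    case (Suc x)
    then obtain u where u: "prim_rec G H x ys = Some u" "H (u # x # ys) = Some v"
      by (auto simp: bind_eq_Some_conv)
    have "\<forall>\<^sub>F T in sequentially. EH (T # u # x # ys) = Suc v"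
      by (rule approximates_complete[OF H _ u(2)]) (simp add: that(1))
    with Suc.IH[OF u(1)] show ?case
      by eventually_elim (simp add: R_Suc)
  qed
  show ?thesis
  proof (rule approximatesI)
    fix ys :: "nat list" and T v
    assume "length ys = p + 1"
      and *: "rec_nat (EG ((T # ys) ! 0 # drop 2 (T # ys))) (\<lambda>x r. if r = 0 then 0
        else EH ((T # ys) ! 0 # (r - 1) # x # drop 2 (T # ys))) ((T # ys) ! 1) = Suc v"
    then obtain x zs where "ys = x # zs" "length zs = p"
      by (cases ys) auto
    with * sound[of zs T x v] show "prim_rec G H (hd ys) (tl ys) = Some v"
      by (simp add: R_def cong: if_cong)
  next
    fix ys :: "nat list" and v
    assume "length ys = p + 1" and *: "prim_rec G H (hd ys) (tl ys) = Some v"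
    then obtain x zs where "ys = x # zs" "length zs = p"
      by (cases ys) auto
    with * complete[of zs x v] show "\<forall>\<^sub>F T in sequentially.
        rec_nat (EG ((T # ys) ! 0 # drop 2 (T # ys))) (\<lambda>x r. if r = 0 then 0
          else EH ((T # ys) ! 0 # (r - 1) # x # drop 2 (T # ys))) ((T # ys) ! 1) = Suc v"
      by (simp add: R_def cong: if_cong)
  qed
qed

section \<open>Bounded search for a least zero\<close>

text \<open>
  The state of the bounded search after \<open>k\<close> steps: \<open>0\<close> when some value could not be evaluated,
  \<open>1\<close> while searching, and \<open>n + 2\<close> when the least zero \<open>n\<close> has been found.
\<close>

definition search :: "(nat \<Rightarrow> nat) \<Rightarrow> nat \<Rightarrow> nat" where
  "search e = rec_nat 1 (\<lambda>k r. if r - 1 = 0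
     then (if r = 0 then 0 else if e k = 0 then 0 else if e k - 1 = 0 then Suc (Suc k) else 1)
     else r)"

lemma search_0: "search e 0 = 1"
  by (simp add: search_def)

text \<open>The nested zero tests of the definition suit \<open>if_zero\<close>; they amount to one
  test for the state \<open>1\<close>, all other states being final.\<close>

lemma search_Suc: "search e (Suc k) = (if search e k = 1
    then (if e k = 0 then 0 else if e k = 1 then Suc (Suc k) else 1) else search e k)"
proof -
  have *: "r - 1 = 0 \<longleftrightarrow> r = 0 \<or> r = 1" for r :: nat
    by arith
  show ?thesis
    unfolding search_def * by (simp only: nat.rec) simp
qed

lemma search_eq_1: "search e k = 1 \<Longrightarrow> m < k \<Longrightarrow> e m > 1"
proof (induction k)
  case (Suc k)
  from Suc.prems(1) have "search e k = 1" "e k > 1"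
    by (cases "search e k = 1"; cases "e k = 0"; cases "e k = 1"; simp add: search_Suc)+
  with Suc.IH Suc.prems(2) show ?case by (cases "m = k") simp_all
qed simp

lemma search_found:
  "search e k = Suc (Suc n) \<Longrightarrow> e n = 1 \<and> (\<forall>m<n. e m > 1)"
proof (induction k)
  case (Suc k)
  show ?case
  proof (cases "search e k = 1")
    case True
    with Suc.prems have "k = n" "e n = 1"
      by (auto simp: search_Suc split: if_splits)
    with search_eq_1[OF True] show ?thesis by simp
  next
    case False
    with Suc.prems have "search e k = Suc (Suc n)"
      by (simp add: search_Suc)
    then show ?thesis by (rule Suc.IH)
  qed
qed (simp add: search_0)

text \<open>The state is \<open>1\<close> up to step \<open>n\<close>, becomes \<open>n + 2\<close>
  in the next step and never changes again.\<close>

lemma search_finds: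
  assumes "e n = 1" "\<And>m. m < n \<Longrightarrow> e m > 1" "n < k"
  shows "search e k = Suc (Suc n)"
proof -
  have searching: "search e m = 1" if "m \<le> n" for m
    using that
  proof (induction m)
    case (Suc m)
    then show ?case using assms(2)[of m] by (simp add: search_Suc)
  qed (simp add: search_0)
  from \<open>n < k\<close> have "Suc n \<le> k" by simp
  then show ?thesis
  proof (induction k rule: dec_induct)
    case base
    then show ?case using searching[of n] assms(1) by (simp add: search_Suc)
  next
    case (step k)
    then show ?case by (simp add: search_Suc)
  qed
qed

text \<open>\<open>T\<close> is both the bound for evaluating \<open>F\<close> and the number of
  search steps. Subtracting \<open>1\<close> turns the state \<open>n + 2\<close> into
  \<open>Suc n\<close>, and the states \<open>0\<close> and \<open>1\<close> into
  \<open>0\<close>.\<close>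

lemma approximates_minimize:
  assumes E: "approximates (p + 1) E F"
  shows "approximates p
    (\<lambda>v. search (\<lambda>n. E (v ! 0 # n # drop 1 v)) (v ! 0) - 1) (minimize F)"
proof (rule approximatesI)
  fix ys T n
  assume ys: "length ys = p"
    and "search (\<lambda>n. E ((T # ys) ! 0 # n # drop 1 (T # ys))) ((T # ys) ! 0) - 1 = Suc n"
  then have "search (\<lambda>n. E (T # n # ys)) T = Suc (Suc n)"
    by simp
  \<comment> \<open>As \<open>E\<close> holds successors of values, \<open>Suc 0\<close> means that
    \<open>F\<close> is \<open>0\<close>, and \<open>E > 1\<close> that \<open>F\<close> is
    positive.\<close>
  from search_found[OF this] have n: "E (T # n # ys) = Suc 0"
    and m: "\<And>m. m < n \<Longrightarrow> E (T # m # ys) > 1"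
    by auto
  have sound: "E (T # m # ys) = Suc v \<Longrightarrow> F (m # ys) = Some v" for m v
    using approximates_sound[OF E, of "m # ys" T] ys by simp
  have 0: "F (n # ys) = Some 0"
    using n by (rule sound)
  have pos: "\<exists>v. F (m # ys) = Some (Suc v)" if "m < n" for m
  proof -
    have "E (T # m # ys) = Suc (Suc (E (T # m # ys) - 2))"
      using m[OF that] by simp
    from sound[OF this] show ?thesis by blast
  qed
  have "(LEAST n. F (n # ys) = Some 0) = n"
  proof (rule Least_equality)
    show "n \<le> k" if "F (k # ys) = Some 0" for k
      using pos[of k] that by (cases "k < n") auto
  qed (fact 0)
  moreover have "\<forall>m<n. F (m # ys) \<noteq> None"
    using pos by blast
  ultimately show "minimize F ys = Some n"
    unfolding minimize_def using 0 by metis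
next
  fix ys n
  assume ys: "length ys = p" and min: "minimize F ys = Some n"
  then obtain k where k: "F (k # ys) = Some 0" "\<forall>m<k. F (m # ys) \<noteq> None"
    and n: "n = (LEAST n. F (n # ys) = Some 0)"
    by (auto simp: minimize_def split: if_splits)
  have F_n: "F (n # ys) = Some 0"
    unfolding n using k(1) by (rule LeastI)
  \<comment> \<open>All values before the witness \<open>k\<close> are defined;
    \<open>n \<le> k\<close> hands this down to \<open>n\<close>.\<close>
  have "n \<le> k"
    unfolding n using k(1) by (rule Least_le)
  have F_m: "\<exists>v. F (m # ys) = Some (Suc v)" if less: "m < n" for m
  proof -
    have "F (m # ys) \<noteq> Some 0"
      using less not_less_Least[of m "\<lambda>n. F (n # ys) = Some 0"] unfolding n by simp
    moreover obtain v where "F (m # ys) = Some v"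
      using k(2) less \<open>n \<le> k\<close> by fastforce
    ultimately show ?thesis by (cases v) auto
  qed
  have complete: "\<forall>\<^sub>F T in sequentially. E (T # m # ys) = Suc v" if "F (m # ys) = Some v" for m v
    using approximates_complete[OF E _ that] ys by simp
  have "\<forall>\<^sub>F T in sequentially. \<forall>m\<in>{..<n}. E (T # m # ys) > 1"
  proof (intro eventually_ball_finite ballI)
    fix m assume "m \<in> {..<n}"
    then obtain v where "F (m # ys) = Some (Suc v)"
      using F_m by auto
    from complete[OF this] show "\<forall>\<^sub>F T in sequentially. E (T # m # ys) > 1"
      by eventually_elim simp
  qed simp
  moreover have "\<forall>\<^sub>F T in sequentially. E (T # n # ys) = Suc 0"
    using F_n by (rule complete)
  moreover have "\<forall>\<^sub>F T in sequentially. n < T"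
    by (rule eventually_gt_at_top)
  ultimately show "\<forall>\<^sub>F T in sequentially.
      search (\<lambda>n. E ((T # ys) ! 0 # n # drop 1 (T # ys))) ((T # ys) ! 0) - 1 = Suc n"
    by eventually_elim (simp add: search_finds)
qed

section \<open>Kleene's normal form\<close>

context primrec_closed
begin

text \<open>The unbounded search of \<open>minimize\<close> becomes one bounded by \<open>T\<close>,
  so that \<open>E\<close> never leaves a class closed under primitive recursion.\<close>

lemma partial_recursive_approximation:
  assumes "partial_recursive p F"
  shows "\<exists>E. C (p + 1) E \<and> approximates p E F"
  using assms
proof (induction rule: partial_recursive.induct)
  case (zero p)
  have "approximates p (\<lambda>v. 1) (\<lambda>v. Some 0)"
    by (simp add: approximates_def)
  then show ?case using const by blast
next
  case (proj i p)
  then have "C (p + 1) (\<lambda>v. Suc (v ! Suc i))"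
    by (intro Suc nth) simp
  moreover have "approximates p (\<lambda>v. Suc (v ! Suc i)) (\<lambda>v. Some (v ! i))"
    by (simp add: approximates_def)
  ultimately show ?case by blast
next
  case succ
  have "C (1 + 1) (\<lambda>v. Suc (Suc (v ! 1)))"
    by (intro Suc nth) simp
  moreover have "approximates 1 (\<lambda>v. Suc (Suc (v ! 1))) (\<lambda>v. Some (v ! 0 + 1))"
    by (simp add: approximates_def)
  ultimately show ?case by blast
next
  case (comp Gs F p)
  then obtain E where E: "C (length Gs + 1) E" "approximates (length Gs) E F"
    by blast
  from comp.IH(2) obtain e
    where e: "\<And>G. G \<in> set Gs \<Longrightarrow> C (p + 1) (e G)" "\<And>G. G \<in> set Gs \<Longrightarrow> approximates p (e G) G"
    by metis
  let ?gs = "(\<lambda>v. v ! 0) # map (\<lambda>G v. e G v - 1) Gs"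
  have "C (p + 1) (\<lambda>v. E (map (\<lambda>g. g v) ?gs))"
    by (rule compose)
      (use E(1) e(1) in \<open>auto intro!: pred[simplified] nth\<close>)
  then have "C (p + 1) (\<lambda>v. E (v ! 0 # map (\<lambda>G. e G v - 1) Gs))"
    by (simp add: comp_def)
  then have "C (p + 1) (\<lambda>v. if \<exists>a\<in>set (map e Gs). a v = 0 then 0
      else E (v ! 0 # map (\<lambda>G. e G v - 1) Gs))"
    by (intro if_any_zero) (use e(1) in auto)
  with approximates_comp[OF E(2) e(2)] show ?case by blast
next
  case (prim_rec p G H)
  then obtain EG EH where G: "C (p + 1) EG" "approximates p EG G"
    and H: "C (p + 2 + 1) EH" "approximates (p + 2) EH H"
    by blast
  have g: "C (p + 2) (\<lambda>v. EG (v ! 0 # drop 2 v))"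
    using comp_drop[of "[\<lambda>v. v ! 0]" p EG 2] G(1) by (simp add: nth)
  \<comment> \<open>In a step the list is \<open>r # x # T # n # ys\<close> with \<open>n\<close>
    the recursion bound: \<open>v ! 2\<close> is \<open>T\<close> and \<open>drop 4 v\<close> is
    \<open>ys\<close>.\<close>
  have EH: "C (p + 4) (\<lambda>v. EH ([v ! 2, v ! 0 - 1, v ! 1] @ drop 4 v))"
    using comp_drop[of "[\<lambda>v. v ! 2, \<lambda>v. v ! 0 - 1, \<lambda>v. v ! 1]" p EH 4] H(1)
    by (simp add: numeral_3_eq_3 nth pred[simplified])
  have "p + 2 + 2 = p + 4" by simp
  then have "C (p + 2 + 2)
      (\<lambda>v. if v ! 0 = 0 then 0 else EH ([v ! 2, v ! 0 - 1, v ! 1] @ drop 4 v))"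
    by (simp only:) (intro if_zero const nth EH; simp)
  from rec_nat[OF _ g this, of "\<lambda>v. v ! 1"]
  have "C (p + 1 + 1) (\<lambda>v. rec_nat (EG (v ! 0 # drop 2 v))
      (\<lambda>x r. if r = 0 then 0 else EH (v ! 0 # (r - 1) # x # drop 2 v)) (v ! 1))"
    by (simp add: nth cong: if_cong)
  with approximates_prim_rec[OF G(2) H(2)] show ?case by blast
next
  case (minimize p F)
  then obtain E where E: "C (p + 1 + 1) E" "approximates (p + 1) E F"
    by blast
  \<comment> \<open>In a step the list is \<open>r # k # T # ys\<close> with search state
    \<open>r\<close> and position \<open>k\<close>.\<close>
  let ?e = "\<lambda>v. E ([v ! 2, v ! 1] @ drop 3 v)"
  have "C (p + 3) ?e"
    using comp_drop[of "[\<lambda>v. v ! 2, \<lambda>v. v ! 1]" p E 3] E(1) by (simp add: numeral_3_eq_3 nth)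
  then have e: "C (p + 1 + 2) ?e"
    by (simp add: numeral_3_eq_3)
  have "C (p + 1 + 2) (\<lambda>v. if v ! 0 - 1 = 0
     then (if v ! 0 = 0 then 0 else if ?e v = 0 then 0 else if ?e v - 1 = 0 then Suc (Suc (v ! 1))
       else 1) else v ! 0)"
    by (intro if_zero const pred Suc e nth) simp_all
  from rec_nat[OF _ const this, of "\<lambda>v. v ! 0" 1]
  have "C (p + 1) (\<lambda>v. search (\<lambda>n. E (v ! 0 # n # drop 1 v)) (v ! 0))"
    by (simp add: nth search_def cong: if_cong)
  from pred[OF this] approximates_minimize[OF E(2)] show ?case by blast
next
  case (ext p F F')
  then obtain E where "C (p + 1) E" "approximates p E F"
    by blast
  moreover from this ext.hyps have "approximates p E F'"
    by (simp add: approximates_def)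
  ultimately show ?case by blast
qed

end

text \<open>Take \<open>E\<close> for \<open>h2\<close> and \<open>E - 1\<close> for
  \<open>h1\<close>: completeness gives some \<open>T\<close> with \<open>E\<close> nonzero, and
  soundness makes the value at the least such \<open>T\<close> correct.\<close>

lemma total_recursive_imp_ode_computable:
  assumes "total_recursive p f"
  shows "ode_computable p f"
proof -
  obtain E where E: "ode_class (p + 1) E" "approximates p E (\<lambda>v. Some (f v))"
    using ode.partial_recursive_approximation assms unfolding total_recursive_def by blast
  have "(\<exists>T. E (T # ys) \<noteq> 0) \<and> f ys = E ((LEAST T. E (T # ys) \<noteq> 0) # ys) - 1"
    if ys: "length ys = p" for ys
  proof -
    have "\<forall>\<^sub>F T in sequentially. E (T # ys) = Suc (f ys)"
      by (rule approximates_complete[OF E(2) ys]) simp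
    then obtain T where "E (T # ys) = Suc (f ys)"
      unfolding eventually_sequentially by blast
    then have ex: "\<exists>T. E (T # ys) \<noteq> 0"
      by (intro exI[of _ T]) simp
    then have "E ((LEAST T. E (T # ys) \<noteq> 0) # ys) \<noteq> 0"
      by (rule LeastI_ex)
    then have "E ((LEAST T. E (T # ys) \<noteq> 0) # ys) = Suc (f ys)"
      using approximates_sound[OF E(2) ys, of "LEAST T. E (T # ys) \<noteq> 0"]
      by (cases "E ((LEAST T. E (T # ys) \<noteq> 0) # ys)") auto
    with ex show ?thesis by simp
  qed
  with E(1) ode.pred[OF E(1)] show ?thesis
    unfolding ode_computable_def by blast
qed

theorem mainTheorem6:
  fixes p :: nat and f :: "nat list \<Rightarrow> nat"
  shows "ode_computable p f \<longleftrightarrow> total_recursive p f"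
  using ode_computable_imp_total_recursive total_recursive_imp_ode_computable by blast

end
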